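(* Let $p$ be a prime and let $Y \in \mathcal{C}(\mathbb{Z}_p)$ be a nonempty $p$-adic path set fractal. Let $Y := (\bar f_p, \mathcal{G}, v_0)$ be any standard presentation of $Y$. Then the Hausdorff dimension $d_H(Y)$ of $Y$ is given by $$d_H(Y) = \log_p \sigma(A(\mathcal{G})) = \frac{\log \sigma(A(\mathcal{G}))}{\log p},$$ where $\sigma(A(\mathcal{G}))$ denotes the spectral radius of the adjacency matrix $A(\mathcal{G}) = [a_{i,j}]$ of $\mathcal{G}$, in which $a_{i,j}$ counts the number of directed edges from vertex $i$ to vertex $j$ of the underlying directed graph of $\mathcal{G}$.
   Context: Let $\mathcal{A}$ be a finite alphabet and $\mathbb{N}=\{0,1,2,\dots\}$. A pointed labeled graph $(\mathcal{G},v)$ over $\mathcal{A}$ consists of a finite directed graph (loops and multiple edges allowed) whose edges are labeled by elements of $\mathcal{A}$, with a marked vertex $v$. Its path set $X_{\mathcal{G}}(v) \subset \mathcal{A}^{\mathbb{N}}$ is the set of label sequences of all one-sided infinite directed walks in $\mathcal{G}$ starting at $v$; $(\mathcal{G},v)$ is called a (path set) presentation of it. Given a digit assignment map $\bar f_p: \mathcal{A} \to \{0,1,\dots,p-1\}$ (not necessarily injective), let $f_p: \mathcal{A}^{\mathbb{N}} \to \mathbb{Z}_p$, $f_p(a_0a_1a_2\cdots) = \sum_{k\ge 0} \bar f_p(a_k)p^k$. A $p$-adic path set fractal is a set $Y = f_p(X_{\mathcal{G}}(v)) \subset \mathbb{Z}_p$ for some such data; $(\bar f_p, \mathcal{G},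 v)$ is called a presentation of $Y$, written $Y := (\bar f_p,\mathcal{G},v)$. $\mathcal{C}(\mathbb{Z}_p)$ denotes the collection of all $p$-adic path set fractals. A presentation $(\bar f_p,\mathcal{G},v)$ is: injective if $\bar f_p$ is one-to-one; right-resolving if at each vertex of $\mathcal{G}$ all exiting edges have different labels; reachable if every vertex of $\mathcal{G}$ can be reached by a directed path from $v$. It is a standard presentation if it is injective, right-resolving and reachable. Hausdorff dimension on $\mathbb{Z}_p$ is taken with respect to the $p$-adic metric. *)

theory Defs
  imports
    "HOL-Analysis.Abstract_Metric_Spaces"
    "HOL-Library.Extended_Nonnegative_Real"
    "Graph_Theory.Digraph"
    "Jordan_Normal_Form.Spectral_Radius"
begin

section \<open>The metric space of \<open>p\<close>-adic integers\<close>

text \<open>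
  \<open>\<int>\<^sub>p\<close> is the inverse limit of the rings \<open>\<int>/p\<^sup>n\<close>: a \<open>p\<close>-adic integer \<open>x\<close> is a coherent sequence
  whose \<open>n\<close>-th entry is the representative in \<open>{0..<p\<^sup>n}\<close> of \<open>x\<close> modulo \<open>p\<^sup>n\<close>.
\<close>

definition padic_ints :: "nat \<Rightarrow> (nat \<Rightarrow> int) set" where
  "padic_ints p = {x. (\<forall>n. x n \<in> {0..<int p ^ n}) \<and> (\<forall>n. x (Suc n) mod int p ^ n = x n)}"

definition padic_of_int :: "nat \<Rightarrow> int \<Rightarrow> nat \<Rightarrow> int" where
  "padic_of_int p z = (\<lambda>n. z mod int p ^ n)"

definition padic_diff :: "nat \<Rightarrow> (nat \<Rightarrow> int) \<Rightarrow> (nat \<Rightarrow> int) \<Rightarrow> nat \<Rightarrow> int" where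
  "padic_diff p x y = (\<lambda>n. (x n - y n) mod int p ^ n)"

text \<open>\<open>p\<^sup>n\<close> divides \<open>x\<close> in \<open>\<int>\<^sub>p\<close> iff the residue of \<open>x\<close> modulo \<open>p\<^sup>n\<close> vanishes; only used for \<open>x \<noteq> 0\<close>.\<close>

definition padic_val :: "(nat \<Rightarrow> int) \<Rightarrow> nat" where
  "padic_val x = (GREATEST n. x n = 0)"

definition padic_norm :: "nat \<Rightarrow> (nat \<Rightarrow> int) \<Rightarrow> real" where
  "padic_norm p x = (if x = (\<lambda>_. 0) then 0 else 1 / real p ^ padic_val x)"

definition padic_dist :: "nat \<Rightarrow> (nat \<Rightarrow> int) \<Rightarrow> (nat \<Rightarrow> int) \<Rightarrow> real" where
  "padic_dist p x y = padic_norm p (padic_diff p x y)"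


section \<open>Hausdorff measure and dimension in a metric space\<close>

definition set_diam :: "('x \<Rightarrow> 'x \<Rightarrow> real) \<Rightarrow> 'x set \<Rightarrow> real" where
  "set_diam d U = (if U = {} then 0 else (SUP xy\<in>U \<times> U. d (fst xy) (snd xy)))"

text \<open>
  The summand \<open>(diam U)\<^sup>s\<close>, with the usual conventions: it is \<open>1\<close> for \<open>s = 0\<close> and \<open>U\<close> nonempty
  (whereas \<open>0 powr 0 = 0\<close> in HOL), and \<open>0\<close> for \<open>U\<close> empty.
\<close>

definition diam_powr :: "('x \<Rightarrow> 'x \<Rightarrow> real) \<Rightarrow> real \<Rightarrow> 'x set \<Rightarrow> real" where
  "diam_powr d s U = (if U = {} then 0 else if s = 0 then 1 else set_diam d U powr s)"

text \<open>
  Countable covers of \<open>Y\<close> by sets of diameter at most \<open>\<delta>\<close>. The bound is imposed on pairs of points,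
  since the real supremum in \<^const>\<open>set_diam\<close> is only meaningful for bounded sets.
\<close>

definition delta_covers ::
    "'x set \<Rightarrow> ('x \<Rightarrow> 'x \<Rightarrow> real) \<Rightarrow> real \<Rightarrow> 'x set \<Rightarrow> (nat \<Rightarrow> 'x set) set" where
  "delta_covers M d \<delta> Y =
     {U. (\<forall>i. U i \<subseteq> M) \<and> (\<forall>i. \<forall>x\<in>U i. \<forall>y\<in>U i. d x y \<le> \<delta>) \<and> Y \<subseteq> (\<Union>i. U i)}"

definition hausdorff_premeasure ::
    "'x set \<Rightarrow> ('x \<Rightarrow> 'x \<Rightarrow> real) \<Rightarrow> real \<Rightarrow> real \<Rightarrow> 'x set \<Rightarrow> ennreal" where
  "hausdorff_premeasure M d s \<delta> Y =
     (INF U\<in>delta_covers M d \<delta> Y. \<Sum>i. ennreal (diam_powr d s (U i)))"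

definition hausdorff_measure ::
    "'x set \<Rightarrow> ('x \<Rightarrow> 'x \<Rightarrow> real) \<Rightarrow> real \<Rightarrow> 'x set \<Rightarrow> ennreal" where
  "hausdorff_measure M d s Y = (SUP \<delta>\<in>{0<..}. hausdorff_premeasure M d s \<delta> Y)"

definition hausdorff_dim :: "'x set \<Rightarrow> ('x \<Rightarrow> 'x \<Rightarrow> real) \<Rightarrow> 'x set \<Rightarrow> ereal" where
  "hausdorff_dim M d Y = Inf (ereal ` {s. 0 \<le> s \<and> hausdorff_measure M d s Y = 0})"


section \<open>Path sets and \<open>p\<close>-adic path set fractals\<close>

definition pointed_labeled_graph ::
    "'a set \<Rightarrow> ('v, 'e) pre_digraph \<Rightarrow> ('e \<Rightarrow> 'a) \<Rightarrow> 'v \<Rightarrow> bool" where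
  "pointed_labeled_graph A G lab v \<longleftrightarrow>
     finite A \<and> fin_digraph G \<and> (\<forall>e\<in>arcs G. lab e \<in> A) \<and> v \<in> verts G"

definition infinite_walk :: "('v, 'e) pre_digraph \<Rightarrow> 'v \<Rightarrow> (nat \<Rightarrow> 'e) \<Rightarrow> bool" where
  "infinite_walk G v w \<longleftrightarrow>
     (\<forall>n. w n \<in> arcs G) \<and> tail G (w 0) = v \<and> (\<forall>n. head G (w n) = tail G (w (Suc n)))"

definition path_set :: "('v, 'e) pre_digraph \<Rightarrow> ('e \<Rightarrow> 'a) \<Rightarrow> 'v \<Rightarrow> (nat \<Rightarrow> 'a) set" where
  "path_set G lab v = {\<lambda>n. lab (w n) | w. infinite_walk G v w}"

text \<open>
  The value of the series \<open>\<Sum>k. fbar (a k) * p^k\<close> in \<open>\<int>\<^sub>p\<close>: modulo \<open>p\<^sup>n\<close> only the terms with \<open>k < n\<close>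
  contribute. Convergence in the \<open>p\<close>-adic metric is \<open>limitin_digit_map\<close> below.
\<close>

definition digit_map :: "nat \<Rightarrow> ('a \<Rightarrow> nat) \<Rightarrow> (nat \<Rightarrow> 'a) \<Rightarrow> nat \<Rightarrow> int" where
  "digit_map p fbar a = (\<lambda>n. (\<Sum>k<n. int (fbar (a k)) * int p ^ k) mod int p ^ n)"

definition presentation ::
    "nat \<Rightarrow> 'a set \<Rightarrow> ('a \<Rightarrow> nat) \<Rightarrow> ('v, 'e) pre_digraph \<Rightarrow> ('e \<Rightarrow> 'a) \<Rightarrow> 'v \<Rightarrow> (nat \<Rightarrow> int) set \<Rightarrow> bool"
  where
  "presentation p A fbar G lab v Y \<longleftrightarrow>
     pointed_labeled_graph A G lab v \<and> (\<forall>a\<in>A. fbar a < p) \<and> Y = digit_map p fbar ` path_set G lab v"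

text \<open>
  Alphabet, vertices and edges are finite sets, so restricting them to natural numbers loses
  nothing; see \<open>presentation_imp_fractal\<close> below.
\<close>

definition padic_path_set_fractals :: "nat \<Rightarrow> (nat \<Rightarrow> int) set set" where
  "padic_path_set_fractals p =
     {Y. \<exists>(A :: nat set) fbar (G :: (nat, nat) pre_digraph) lab v. presentation p A fbar G lab v Y}"

definition right_resolving :: "('v, 'e) pre_digraph \<Rightarrow> ('e \<Rightarrow> 'a) \<Rightarrow> bool" where
  "right_resolving G lab \<longleftrightarrow> (\<forall>u\<in>verts G. inj_on lab {e \<in> arcs G. tail G e = u})"

definition all_reachable :: "('v, 'e) pre_digraph \<Rightarrow> 'v \<Rightarrow> bool" where
  "all_reachable G v \<longleftrightarrow> (\<forall>u\<in>verts G. reachable G v u)"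

definition standard_presentation ::
    "nat \<Rightarrow> 'a set \<Rightarrow> ('a \<Rightarrow> nat) \<Rightarrow> ('v, 'e) pre_digraph \<Rightarrow> ('e \<Rightarrow> 'a) \<Rightarrow> 'v \<Rightarrow> (nat \<Rightarrow> int) set \<Rightarrow> bool"
  where
  "standard_presentation p A fbar G lab v Y \<longleftrightarrow>
     presentation p A fbar G lab v Y \<and> inj_on fbar A \<and> right_resolving G lab \<and> all_reachable G v"

text \<open>The adjacency matrix with respect to an enumeration \<open>vs\<close> of the vertices.\<close>

definition adjacency_matrix :: "('v, 'e) pre_digraph \<Rightarrow> 'v list \<Rightarrow> complex mat" where
  "adjacency_matrix G vs =
     mat (length vs) (length vs)
       (\<lambda>(i, j). of_nat (card {e \<in> arcs G. tail G e = vs ! i \<and> head G e = vs ! j}))"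


section \<open>Consistency of the definitions\<close>

lemma padic_ints_bounds: "x \<in> padic_ints p \<Longrightarrow> 0 \<le> x n \<and> x n < int p ^ n"
  unfolding padic_ints_def by force

lemma padic_ints_mono_mod:
  assumes "x \<in> padic_ints p" "m \<le> n"
  shows "x n mod int p ^ m = x m"
  using assms(2)
proof (induction n rule: dec_induct)
  case base
  then show ?case using padic_ints_bounds[OF assms(1), of m] by simp
next
  case (step n)
  have "x (Suc n) mod int p ^ m = (x (Suc n) mod int p ^ n) mod int p ^ m"
    using step by (simp add: mod_mod_cancel le_imp_power_dvd)
  also have "x (Suc n) mod int p ^ n = x n"
    using assms(1) unfolding padic_ints_def by blast
  finally show ?case using step by simp
qed

lemma padic_diff_eq_0:
  assumes "x \<in> padic_ints p" "y \<in> padic_ints p"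
  shows "padic_diff p x y n = 0 \<longleftrightarrow> x n = y n"
proof -
  have "padic_diff p x y n = 0 \<longleftrightarrow> x n mod int p ^ n = y n mod int p ^ n"
    unfolding padic_diff_def by (metis mod_eq_dvd_iff dvd_eq_mod_eq_0)
  then show ?thesis
    using padic_ints_mono_mod[OF assms(1), of n n] padic_ints_mono_mod[OF assms(2), of n n] by simp
qed

lemma padic_dist_le_iff:
  assumes p: "p \<ge> 2" and x: "x \<in> padic_ints p" and y: "y \<in> padic_ints p"
  shows "padic_dist p x y \<le> 1 / real p ^ n \<longleftrightarrow> x n = y n"
proof (cases "x = y")
  case True
  then show ?thesis
    by (simp add: padic_dist_def padic_norm_def padic_diff_def)
next
  case False
  then obtain m where m: "x m \<noteq> y m" by auto
  have nz: "padic_diff p x y \<noteq> (\<lambda>_. 0)"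
    using m padic_diff_eq_0[OF x y, of m] by auto
  have down: "x i = y i" if "i \<le> j" "x j = y j" for i j
    using padic_ints_mono_mod[OF x that(1)] padic_ints_mono_mod[OF y that(1)] that(2) by simp
  have bound: "i \<le> m" if "x i = y i" for i
    using down[of m i] that m by linarith
  define g where "g = (GREATEST i. x i = y i)"
  have val: "padic_val (padic_diff p x y) = g"
    unfolding padic_val_def g_def using padic_diff_eq_0[OF x y] by simp
  have "x 0 = y 0" using padic_ints_bounds[OF x, of 0] padic_ints_bounds[OF y, of 0] by simp
  then have g: "x g = y g" unfolding g_def by (rule GreatestI_nat) (use bound in blast)
  have g_max: "i \<le> g" if "x i = y i" for i
    unfolding g_def using that by (rule Greatest_le_nat) (use bound in blast)
  have "padic_dist p x y \<le> 1 / real p ^ n \<longleftrightarrow> real p ^ n \<le> real p ^ g"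
    using nz p by (simp add: padic_dist_def padic_norm_def val field_simps)
  also have "\<dots> \<longleftrightarrow> n \<le> g" using p by (simp add: power_increasing_iff)
  also have "\<dots> \<longleftrightarrow> x n = y n" using down[OF _ g] g_max by blast
  finally show ?thesis .
qed

lemma padic_dist_cases:
  "padic_dist p x y = 0 \<or> (\<exists>n. padic_dist p x y = 1 / real p ^ n)"
  by (auto simp: padic_dist_def padic_norm_def)

lemma padic_dist_leI:
  assumes "p \<ge> 2" "\<And>n. padic_dist p x y \<le> 1 / real p ^ n \<Longrightarrow> padic_dist p x' y' \<le> 1 / real p ^ n"
  shows "padic_dist p x' y' \<le> padic_dist p x y"
proof (cases "padic_dist p x y = 0")
  case False
  then obtain n where "padic_dist p x y = 1 / real p ^ n"
    using padic_dist_cases by blast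
  then show ?thesis using assms(2)[of n] by simp
next
  case True
  have "padic_dist p x' y' \<le> 0"
  proof (rule ccontr)
    assume c: "\<not> padic_dist p x' y' \<le> 0"
    then obtain n where n: "padic_dist p x' y' = 1 / real p ^ n"
      using padic_dist_cases[of p x' y'] by auto
    have "padic_dist p x' y' \<le> 1 / real p ^ Suc n" using assms(2)[of "Suc n"] True by simp
    then show False using n assms(1) by (simp add: field_simps)
  qed
  then show ?thesis using True by simp
qed

lemma Metric_space_padic:
  assumes p: "p \<ge> 2"
  shows "Metric_space (padic_ints p) (padic_dist p)"
proof
  fix x y
  show "0 \<le> padic_dist p x y"
    by (simp add: padic_dist_def padic_norm_def)
  have *: "padic_diff p x y n = 0 \<longleftrightarrow> padic_diff p y x n = 0" for n x y
    unfolding padic_diff_def by (metis dvd_eq_mod_eq_0 dvd_minus_iff minus_diff_eq)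
  then have "padic_val (padic_diff p x y) = padic_val (padic_diff p y x)"
    by (simp add: padic_val_def)
  moreover have "padic_diff p x y = (\<lambda>_. 0) \<longleftrightarrow> padic_diff p y x = (\<lambda>_. 0)"
    unfolding fun_eq_iff using * by blast
  ultimately show "padic_dist p x y = padic_dist p y x"
    by (simp add: padic_dist_def padic_norm_def)
next
  fix x y assume x: "x \<in> padic_ints p" and y: "y \<in> padic_ints p"
  have "padic_dist p x y = 0 \<longleftrightarrow> padic_diff p x y = (\<lambda>_. 0)"
    using p by (simp add: padic_dist_def padic_norm_def)
  then show "padic_dist p x y = 0 \<longleftrightarrow> x = y"
    using padic_diff_eq_0[OF x y] by (auto simp: fun_eq_iff)
next
  fix x y z assume xyz: "x \<in> padic_ints p" "y \<in> padic_ints p" "z \<in> padic_ints p"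
  have nonneg: "0 \<le> padic_dist p a b" for a b
    by (simp add: padic_dist_def padic_norm_def)
  have "padic_dist p x z \<le> padic_dist p x y \<or> padic_dist p x z \<le> padic_dist p y z"
  proof (rule ccontr)
    assume c: "\<not> ?thesis"
    then have "\<not> padic_dist p x z \<le> 0"
      using nonneg[of x y] by linarith
    obtain n where n: "padic_dist p x y \<le> 1 / real p ^ n" "\<not> padic_dist p x z \<le> 1 / real p ^ n"
      using padic_dist_leI[OF p, of x y x z] c by blast
    obtain m where m: "padic_dist p y z \<le> 1 / real p ^ m" "\<not> padic_dist p x z \<le> 1 / real p ^ m"
      using padic_dist_leI[OF p, of y z x z] c by blast
    have eq: "x n = y n" "x n \<noteq> z n" "y m = z m" "x m \<noteq> z m"
      using n m padic_dist_le_iff[OF p] xyz by blast+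
    show False
    proof (cases "n \<le> m")
      case True
      then have "y n = z n"
        using padic_ints_mono_mod[OF xyz(2) True] padic_ints_mono_mod[OF xyz(3) True] eq by simp
      then show False using eq by simp
    next
      case False
      then have "m \<le> n" by simp
      then have "x m = y m"
        using padic_ints_mono_mod[OF xyz(1), of m n] padic_ints_mono_mod[OF xyz(2), of m n] eq by simp
      then show False using eq by simp
    qed
  qed
  then show "padic_dist p x z \<le> padic_dist p x y + padic_dist p y z"
    using nonneg[of x y] nonneg[of y z] by linarith
qed

lemma padic_of_int_in_padic_ints:
  assumes "p \<ge> 2" shows "padic_of_int p z \<in> padic_ints p"
  using assms by (auto simp: padic_ints_def padic_of_int_def mod_mod_cancel)

lemma sum_mod_power:
  assumes "n \<le> N"
  shows "(\<Sum>k<N. (c k :: int) * q ^ k) mod q ^ n = (\<Sum>k<n. c k * q ^ k) mod q ^ n"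
  using assms
proof (induction N rule: dec_induct)
  case (step N)
  have "q ^ n dvd c N * q ^ N" using step by (simp add: le_imp_power_dvd)
  then have "(\<Sum>k<Suc N. c k * q ^ k) mod q ^ n = (\<Sum>k<N. c k * q ^ k) mod q ^ n"
    by (metis sum.lessThan_Suc mod_eq_dvd_iff add_diff_cancel_left')
  then show ?case using step by simp
qed simp

lemma digit_map_in_padic_ints:
  assumes "p \<ge> 2" shows "digit_map p fbar a \<in> padic_ints p"
proof -
  have "digit_map p fbar a (Suc n) mod int p ^ n = digit_map p fbar a n" for n
  proof -
    have "digit_map p fbar a (Suc n) mod int p ^ n =
          (\<Sum>k<Suc n. int (fbar (a k)) * int p ^ k) mod int p ^ n"
      unfolding digit_map_def by (rule mod_mod_cancel) (simp add: le_imp_power_dvd)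
    also have "\<dots> = digit_map p fbar a n"
      unfolding digit_map_def by (rule sum_mod_power) simp
    finally show ?thesis .
  qed
  moreover have "digit_map p fbar a n \<in> {0..<int p ^ n}" for n
    using assms by (simp add: digit_map_def)
  ultimately show ?thesis by (simp add: padic_ints_def)
qed

lemma limitin_digit_map:
  assumes p: "p \<ge> 2"
  shows "limitin (Metric_space.mtopology (padic_ints p) (padic_dist p))
           (\<lambda>N. padic_of_int p (\<Sum>k<N. int (fbar (a k)) * int p ^ k))
           (digit_map p fbar a) sequentially"
proof -
  interpret Metric_space "padic_ints p" "padic_dist p" by (rule Metric_space_padic[OF p])
  have "\<exists>N0. \<forall>N\<ge>N0. padic_dist p (padic_of_int p (\<Sum>k<N. int (fbar (a k)) * int p ^ k))
          (digit_map p fbar a) < \<epsilon>" if \<epsilon>: "\<epsilon> > 0" for \<epsilon>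
  proof -
    have "1 / real p < 1" using p by simp
    from real_arch_pow_inv[OF \<epsilon> this] obtain n where n: "1 / real p ^ n < \<epsilon>"
      by (auto simp: power_one_over)
    have "padic_dist p (padic_of_int p (\<Sum>k<N. int (fbar (a k)) * int p ^ k))
          (digit_map p fbar a) \<le> 1 / real p ^ n" if "N \<ge> n" for N
      unfolding padic_dist_le_iff[OF p padic_of_int_in_padic_ints[OF p] digit_map_in_padic_ints[OF p]]
      using sum_mod_power[OF that] by (simp add: padic_of_int_def digit_map_def)
    then show ?thesis using n by (meson le_less_trans)
  qed
  then show ?thesis
    unfolding limit_metric_sequentially
    using padic_of_int_in_padic_ints[OF p] digit_map_in_padic_ints[OF p] by blast
qed

lemma path_setI: "infinite_walk G v w \<Longrightarrow> (\<lambda>n. lab (w n)) \<in> path_set G lab v"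
  unfolding path_set_def by blast

lemma presentation_imp_fractal:
  fixes A :: "'a set" and G :: "('v, 'e) pre_digraph"
  assumes "presentation p A fbar G lab v Y"
  shows "Y \<in> padic_path_set_fractals p"
proof -
  have finA: "finite A" and fin: "fin_digraph G" and lab: "\<And>e. e \<in> arcs G \<Longrightarrow> lab e \<in> A"
    and v: "v \<in> verts G" and fb: "\<And>a. a \<in> A \<Longrightarrow> fbar a < p"
    and Y: "Y = digit_map p fbar ` path_set G lab v"
    using assms unfolding presentation_def pointed_labeled_graph_def by auto
  interpret fin_digraph G by (rule fin)
  obtain \<alpha> :: "'a \<Rightarrow> nat" where \<alpha>: "inj_on \<alpha> A"
    using finite_imp_inj_to_nat_seg[OF finA] by blast
  obtain \<phi> :: "'v \<Rightarrow> nat" where \<phi>: "inj_on \<phi> (verts G)"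
    using finite_imp_inj_to_nat_seg[OF finite_verts] by blast
  obtain \<psi> :: "'e \<Rightarrow> nat" where \<psi>: "inj_on \<psi> (arcs G)"
    using finite_imp_inj_to_nat_seg[OF finite_arcs] by blast
  define inv\<psi> where "inv\<psi> = inv_into (arcs G) \<psi>"
  have inv1: "\<And>e. e \<in> arcs G \<Longrightarrow> inv\<psi> (\<psi> e) = e"
    unfolding inv\<psi>_def using \<psi> by simp
  define G' :: "(nat, nat) pre_digraph" where
    "G' = \<lparr>verts = \<phi> ` verts G, arcs = \<psi> ` arcs G,
           tail = (\<lambda>e. \<phi> (tail G (inv\<psi> e))), head = (\<lambda>e. \<phi> (head G (inv\<psi> e)))\<rparr>"
  define lab' where "lab' = (\<lambda>e. \<alpha> (lab (inv\<psi> e)))"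
  define fbar' where "fbar' = (\<lambda>a. fbar (inv_into A \<alpha> a))"
  have fbar': "\<And>a. a \<in> A \<Longrightarrow> fbar' (\<alpha> a) = fbar a"
    unfolding fbar'_def using \<alpha> by simp
  have G': "fin_digraph G'"
    by unfold_locales (auto simp: G'_def inv1)
  have walk1: "infinite_walk G' (\<phi> v) (\<lambda>n. \<psi> (w n))" if "infinite_walk G v w" for w
    using that unfolding infinite_walk_def G'_def by (auto simp: inv1)
  have walk2: "infinite_walk G v (\<lambda>n. inv\<psi> (w n))" if w: "infinite_walk G' (\<phi> v) w" for w
  proof -
    have arc: "inv\<psi> (w n) \<in> arcs G" for n
      using w unfolding infinite_walk_def G'_def inv\<psi>_def by (simp add: inv_into_into)
    have "\<phi> (tail G (inv\<psi> (w 0))) = \<phi> v"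
      using w unfolding infinite_walk_def G'_def by simp
    then have "tail G (inv\<psi> (w 0)) = v"
      using inj_onD[OF \<phi>] tail_in_verts[OF arc] v by blast
    moreover have "head G (inv\<psi> (w n)) = tail G (inv\<psi> (w (Suc n)))" for n
    proof -
      have "\<phi> (head G (inv\<psi> (w n))) = \<phi> (tail G (inv\<psi> (w (Suc n))))"
        using w unfolding infinite_walk_def G'_def by simp
      then show ?thesis
        using inj_onD[OF \<phi>] tail_in_verts[OF arc] head_in_verts[OF arc] by blast
    qed
    ultimately show ?thesis using arc unfolding infinite_walk_def by blast
  qed
  have "Y = digit_map p fbar' ` path_set G' lab' (\<phi> v)"
  proof (intro equalityI subsetI)
    fix y assume "y \<in> Y"
    then obtain w where w: "infinite_walk G v w" and y: "y = digit_map p fbar (\<lambda>n. lab (w n))"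
      unfolding Y path_set_def by blast
    have "lab' (\<psi> (w n)) = \<alpha> (lab (w n))" "lab (w n) \<in> A" for n
      using w lab inv1 unfolding infinite_walk_def lab'_def by auto
    then have "y = digit_map p fbar' (\<lambda>n. lab' (\<psi> (w n)))"
      unfolding y digit_map_def by (simp add: fbar')
    then show "y \<in> digit_map p fbar' ` path_set G' lab' (\<phi> v)"
      using imageI[OF path_setI[OF walk1[OF w], of lab'], of "digit_map p fbar'"] by simp
  next
    fix y assume "y \<in> digit_map p fbar' ` path_set G' lab' (\<phi> v)"
    then obtain w where w: "infinite_walk G' (\<phi> v) w" and y: "y = digit_map p fbar' (\<lambda>n. lab' (w n))"
      unfolding path_set_def by blast
    have "lab (inv\<psi> (w n)) \<in> A" for n
      using walk2[OF w] lab unfolding infinite_walk_def by auto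
    then have "y = digit_map p fbar (\<lambda>n. lab (inv\<psi> (w n)))"
      unfolding y digit_map_def lab'_def by (simp add: fbar')
    then show "y \<in> Y"
      using imageI[OF path_setI[OF walk2[OF w], of lab], of "digit_map p fbar"] unfolding Y by simp
  qed
  moreover have "pointed_labeled_graph (\<alpha> ` A) G' lab' (\<phi> v)"
    unfolding pointed_labeled_graph_def using finA G' v lab
    by (auto simp: G'_def lab'_def inv1)
  moreover have "\<forall>a\<in>\<alpha> ` A. fbar' a < p"
    using fb fbar' by auto
  ultimately have "presentation p (\<alpha> ` A) fbar' G' lab' (\<phi> v) Y"
    unfolding presentation_def by blast
  then show ?thesis unfolding padic_path_set_fractals_def by blast
qed

end

theory Submission
  imports Defs "HOL-Analysis.Infinite_Sum"
begin

text \<open>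
  Let \<open>\<rho>\<close> be the spectral radius of the adjacency matrix. Injectivity of the digit assignment makes
  the fractal, looked at modulo \<open>p\<^sup>n\<close>, a faithful picture of the label words of length \<open>n\<close> that are
  read along infinite walks from \<open>v\<^sub>0\<close>, and a residue class modulo \<open>p\<^sup>n\<close> is a ball of
  diameter at most \<open>p\<^sup>-\<^sup>n\<close>.

  \<^emph>\<open>Upper bound.\<close> For every \<open>r > \<rho>\<close> the number of walks of length \<open>n\<close> is \<open>O(r\<^sup>n)\<close>
  (\<open>walk_count_le_power\<close>), so \<open>Y\<close> is covered by \<open>O(r\<^sup>n)\<close> balls of diameter at most \<open>p\<^sup>-\<^sup>n\<close>, and
  the \<open>s\<close>-dimensional measure of \<open>Y\<close> vanishes as soon as \<open>p\<^sup>s > r\<close>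
  (\<open>hausdorff_measure_eq_0_of_few_residues\<close>). The same count shows \<open>\<rho> \<ge> 1\<close>: a nonempty
  \<open>Y\<close> has at least one residue modulo each \<open>p\<^sup>n\<close>, which \<open>O(r\<^sup>n)\<close> with \<open>r < 1\<close> excludes.

  \<^emph>\<open>Lower bound.\<close> The textbook argument puts a mass distribution on \<open>Y\<close> by means of a Perron
  eigenvector. Here a weaker vector suffices: the moduli of the entries of any eigenvector for an
  eigenvalue of modulus \<open>\<rho>\<close> form a weight \<open>y\<close> on the vertices with
  \<open>\<rho> \<cdot> y v \<le> (\<Sum> y (head e))\<close>, the sum ranging over the edges that leave \<open>v\<close>
  (\<open>subinvariant_weight\<close>). It is normalised to have maximum \<open>1\<close>,
  attained at \<open>u\<close>, say.

  Suppose that \<open>p\<^sup>s \<le> \<rho>\<close> and that the \<open>s\<close>-dimensional measure of \<open>Y\<close> were \<open>0\<close>. Then \<open>Y\<close> has covers by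
  residue classes, the \<open>i\<close>-th one modulo \<open>p\<close> to the power \<open>len i\<close>, whose total weight
  \<open>\<Sum> p\<close> to the power \<open>- s \<cdot> len i\<close>, hence also \<open>\<Sum> t\<close> to the power \<open>len i\<close> for \<open>t = 1 / \<rho>\<close>,
  is as small as desired (\<open>hausdorff_null_cylinder_cover\<close>). Choose it smaller than \<open>t\<^sup>k\<close>, where \<open>k\<close>
  is the length of some walk from \<open>v\<^sub>0\<close> to \<open>u\<close>. From \<open>u\<close> on, walk greedily: if the classes inside the
  present residue class modulo \<open>p\<^sup>n\<close> weigh less than \<open>t\<^sup>n \<cdot> y v\<close>, with \<open>v\<close> the present vertex,
  then some edge leaving \<open>v\<close> leads to a vertex at which the same holds for \<open>n + 1\<close>; otherwise one
  could add up over all edges, the subclasses being disjoint because different edges leaving \<open>v\<close>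
  have different digits. The infinite walk so obtained never enters a class of the cover, since a class of level \<open>n\<close>
  alone weighs \<open>t\<^sup>n \<ge> t\<^sup>n \<cdot> y v\<close> (\<open>walk_avoiding_cylinders\<close>). Its point of \<open>Y\<close> is therefore
  uncovered, a contradiction.
\<close>

(* So that $ denotes entries of the vectors of the matrix library only. *)
unbundle no vec_syntax

section \<open>Walks and the spectral radius of the adjacency matrix\<close>

text \<open>
  Parallel edges enter the matrix through their number, so multiplication by the adjacency matrix is
  summation over the outgoing edges. This lets everything below speak of edges only.
\<close>

lemma adjacency_matrix_mult_vec:
  assumes "fin_digraph G" "distinct vs" "set vs = verts G" "i < length vs"
  shows "(adjacency_matrix G vs *\<^sub>v vec (length vs) (\<lambda>j. f (vs ! j))) $ i
           = (\<Sum>e\<in>out_arcs G (vs ! i). f (head G e))"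
proof -
  interpret fin_digraph G by fact
  let ?N = "\<lambda>v. card {e \<in> arcs G. tail G e = vs ! i \<and> head G e = v}"
  have bij: "bij_betw ((!) vs) {0..<length vs} (verts G)"
    using bij_betw_nth[OF assms(2), of "{0..<length vs}" "verts G"] assms(3) by (simp add: atLeast0LessThan)
  have "(adjacency_matrix G vs *\<^sub>v vec (length vs) (\<lambda>j. f (vs ! j))) $ i
      = (\<Sum>j = 0..<length vs. of_nat (?N (vs ! j)) * f (vs ! j))"
    using assms(4) by (simp add: adjacency_matrix_def scalar_prod_def)
  also have "\<dots> = (\<Sum>v\<in>verts G. of_nat (?N v) * f v)"
    by (rule sum.reindex_bij_betw[OF bij])
  also have "\<dots> = (\<Sum>v\<in>verts G. \<Sum>e\<in>{e \<in> out_arcs G (vs ! i). head G e = v}. f (head G e))"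
    by (intro sum.cong) (auto simp: conj_assoc)
  also have "\<dots> = (\<Sum>e\<in>out_arcs G (vs ! i). f (head G e))"
    by (rule sum.group) (auto simp: finite_verts)
  finally show ?thesis .
qed

lemma adjacency_matrix_carrier: "adjacency_matrix G vs \<in> carrier_mat (length vs) (length vs)"
  by (simp add: adjacency_matrix_def)

text \<open>
  The number of walks of length \<open>n\<close> that start at \<open>v\<close>, that is, the row sum at \<open>v\<close> of the
  \<open>n\<close>-th power of the adjacency matrix.
\<close>

fun walk_count :: "('v, 'e) pre_digraph \<Rightarrow> nat \<Rightarrow> 'v \<Rightarrow> nat" where
  "walk_count G 0 v = 1"
| "walk_count G (Suc n) v = (\<Sum>e\<in>out_arcs G v. walk_count G n (head G e))"

text \<open>
  Dividing the matrix by \<open>r\<close> brings its spectral radius below \<open>1\<close>, so the powers of the quotient \<open>B\<close>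
  are bounded by the Jordan normal form theorem; their row sums are the numbers of walks divided by
  \<open>r\<^sup>n\<close>.
\<close>

lemma walk_count_le_power:
  assumes G: "fin_digraph G" "distinct vs" "set vs = verts G"
    and r: "spectral_radius (adjacency_matrix G vs) < r" "0 < r"
  obtains C :: real where "\<And>n v. v \<in> verts G \<Longrightarrow> walk_count G n v \<le> C * r ^ n"
proof -
  let ?m = "length vs" and ?A = "adjacency_matrix G vs"
  define B where "B = complex_of_real (1 / r) \<cdot>\<^sub>m ?A"
  note A = adjacency_matrix_carrier[of G vs]
  have B: "B \<in> carrier_mat ?m ?m" unfolding B_def using A by simp
  have "spectral_radius B < 1" if m: "?m > 0"
  proof -
    obtain k where k: "eigenvalue B k" "spectral_radius B = norm k"
      using spectral_radius_mem_max(1)[OF B m] unfolding spectrum_def by auto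
    then obtain x where x: "x \<in> carrier_vec ?m" "x \<noteq> 0\<^sub>v ?m" "B *\<^sub>v x = k \<cdot>\<^sub>v x"
      unfolding eigenvalue_def eigenvector_def using B by auto
    have "B *\<^sub>v x = complex_of_real (1 / r) \<cdot>\<^sub>v (?A *\<^sub>v x)"
      unfolding B_def using A x(1) by (intro eq_vecI) auto
    with x(3) have "complex_of_real r \<cdot>\<^sub>v (k \<cdot>\<^sub>v x)
        = complex_of_real r \<cdot>\<^sub>v (complex_of_real (1 / r) \<cdot>\<^sub>v (?A *\<^sub>v x))" by simp
    then have "?A *\<^sub>v x = (complex_of_real r * k) \<cdot>\<^sub>v x"
      using r by (simp add: smult_smult_assoc)
    then have "complex_of_real r * k \<in> spectrum ?A"
      unfolding spectrum_def eigenvalue_def eigenvector_def using A x by auto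
    then have "norm (complex_of_real r * k) \<le> spectral_radius ?A"
      using spectral_radius_mem_max(2)[OF A m] by blast
    then have "r * norm k \<le> spectral_radius ?A" using r by (simp add: norm_mult)
    with r(1) have "r * norm k < r * 1" by simp
    then show ?thesis using k r(2) by simp
  qed
  then obtain c where c: "norm_bound (B ^\<^sub>m k) c" if "?m > 0" for k
    using spectral_radius_jnf_norm_bound_less_1_upper_triangular[OF B] by blast
  (* Powers of matrices are built by multiplication on the right, walk counts by adding the first
     edge, which is a multiplication on the left. *)
  have comm: "B * B ^\<^sub>m n = B ^\<^sub>m n * B" for n
  proof (induction n)
    case 0
    then show ?case using B by simp
  next
    case (Suc n)
    have "B * B ^\<^sub>m Suc n = (B * B ^\<^sub>m n) * B"
      using assoc_mult_mat[OF B pow_carrier_mat[OF B] B] by simp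
    then show ?case using Suc by simp
  qed
  define one where "one = vec ?m (\<lambda>_. 1 :: complex)"
  have one: "one \<in> carrier_vec ?m" by (simp add: one_def)
  have count: "B ^\<^sub>m n *\<^sub>v one = vec ?m (\<lambda>i. of_nat (walk_count G n (vs ! i)) / of_real r ^ n)" for n
  proof (induction n)
    case 0
    then show ?case using B one by (auto simp: one_def)
  next
    case (Suc n)
    let ?f = "\<lambda>v. of_nat (walk_count G n v) / of_real r ^ n :: complex"
    have "B ^\<^sub>m Suc n *\<^sub>v one = B *\<^sub>v (B ^\<^sub>m n *\<^sub>v one)"
      unfolding pow_mat.simps comm[symmetric] by (rule assoc_mult_mat_vec[OF B pow_carrier_mat[OF B] one])
    also have "\<dots> = complex_of_real (1 / r) \<cdot>\<^sub>v (?A *\<^sub>v vec ?m (\<lambda>i. ?f (vs ! i)))"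
      unfolding Suc unfolding B_def using A by (intro eq_vecI) auto
    also have "\<dots> = vec ?m (\<lambda>i. of_nat (walk_count G (Suc n) (vs ! i)) / of_real r ^ Suc n)"
    proof (rule eq_vecI)
      fix i assume "i < dim_vec (vec ?m (\<lambda>i. of_nat (walk_count G (Suc n) (vs ! i)) / complex_of_real r ^ Suc n))"
      then have i: "i < ?m" by simp
      have "(?A *\<^sub>v vec ?m (\<lambda>i. ?f (vs ! i))) $ i = (\<Sum>e\<in>out_arcs G (vs ! i). ?f (head G e))"
        by (rule adjacency_matrix_mult_vec[OF G i])
      also have "\<dots> = of_nat (walk_count G (Suc n) (vs ! i)) / of_real r ^ n"
        by (simp add: sum_divide_distrib)
      finally show "(complex_of_real (1 / r) \<cdot>\<^sub>v (?A *\<^sub>v vec ?m (\<lambda>i. ?f (vs ! i)))) $ i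
          = vec ?m (\<lambda>i. of_nat (walk_count G (Suc n) (vs ! i)) / of_real r ^ Suc n) $ i"
        using i A by (simp del: walk_count.simps)
    qed (use A in simp)
    finally show ?case .
  qed
  show thesis
  proof
    fix n v assume "v \<in> verts G"
    then obtain i where i: "i < ?m" "v = vs ! i" using G(3) by (metis in_set_conv_nth)
    have dim: "dim_row (B ^\<^sub>m n) = ?m" "dim_col (B ^\<^sub>m n) = ?m" using B by auto
    have "complex_of_real (walk_count G n v / r ^ n) = (B ^\<^sub>m n *\<^sub>v one) $ i"
      unfolding count using i by simp
    also have "\<dots> = (\<Sum>j = 0..<?m. (B ^\<^sub>m n) $$ (i, j))"
      using i dim by (simp add: scalar_prod_def one_def)
    finally have "walk_count G n v / r ^ n = norm (\<Sum>j = 0..<?m. (B ^\<^sub>m n) $$ (i, j))"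
      using r(2) by (metis abs_of_nonneg divide_nonneg_pos norm_of_real of_nat_0_le_iff zero_less_power)
    also have "\<dots> \<le> (\<Sum>j = 0..<?m. c)"
    proof (rule sum_norm_le)
      fix j assume "j \<in> {0..<?m}"
      then show "norm ((B ^\<^sub>m n) $$ (i, j)) \<le> c"
        using c[of n, unfolded norm_bound_def dim] i(1) by force
    qed
    finally show "walk_count G n v \<le> (?m * c) * r ^ n" using r(2) by (simp add: field_simps)
  qed
qed

text \<open>
  The substitute for a Perron eigenvector: taking moduli in the eigenvector equation for an eigenvalue
  of maximal modulus leaves an inequality, by the triangle inequality. The weight may vanish at some
  vertices; all that is known is that it has maximum \<open>1\<close>.
\<close>

lemma subinvariant_weight:
  assumes G: "fin_digraph G" "distinct vs" "set vs = verts G" and ne: "verts G \<noteq> {}"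
  obtains y :: "'v \<Rightarrow> real" and u where "u \<in> verts (G :: ('v, 'e) pre_digraph)" "y u = 1"
    "\<And>v. v \<in> verts G \<Longrightarrow> y v \<le> 1"
    "\<And>v. v \<in> verts G \<Longrightarrow> spectral_radius (adjacency_matrix G vs) * y v \<le> (\<Sum>e\<in>out_arcs G v. y (head G e))"
proof -
  interpret fin_digraph G by fact
  let ?m = "length vs" and ?A = "adjacency_matrix G vs"
  note A = adjacency_matrix_carrier[of G vs]
  have m: "?m > 0" using ne G(3) by auto
  obtain k where k: "eigenvalue ?A k" "spectral_radius ?A = norm k"
    using spectral_radius_mem_max(1)[OF A m] unfolding spectrum_def by auto
  then obtain x where x: "x \<in> carrier_vec ?m" "x \<noteq> 0\<^sub>v ?m" "?A *\<^sub>v x = k \<cdot>\<^sub>v x"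
    unfolding eigenvalue_def eigenvector_def using A by auto
  define f where "f v = x $ (THE i. i < ?m \<and> vs ! i = v)" for v
  have f: "f (vs ! i) = x $ i" if "i < ?m" for i
    unfolding f_def by (rule arg_cong[where f = "($) x"], rule the_equality)
      (use that G(2) nth_eq_iff_index_eq in auto)
  have x_f: "x = vec ?m (\<lambda>i. f (vs ! i))" using x(1) f by (intro eq_vecI) auto
  have f_eq: "k * f v = (\<Sum>e\<in>out_arcs G v. f (head G e))" if v: "v \<in> verts G" for v
  proof -
    obtain i where i: "i < ?m" "v = vs ! i" using G(3) v by (metis in_set_conv_nth)
    have "k * f v = (?A *\<^sub>v x) $ i" unfolding x(3) using i x(1) f by simp
    also have "\<dots> = (\<Sum>e\<in>out_arcs G v. f (head G e))"
      unfolding i(2) by (subst x_f) (rule adjacency_matrix_mult_vec[OF G i(1)])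
    finally show ?thesis .
  qed
  define M where "M = Max ((\<lambda>v. norm (f v)) ` verts G)"
  have fin: "finite ((\<lambda>v. norm (f v)) ` verts G)" "(\<lambda>v. norm (f v)) ` verts G \<noteq> {}"
    using ne finite_verts by auto
  have M_ge: "norm (f v) \<le> M" if "v \<in> verts G" for v
    unfolding M_def using fin that by (intro Max_ge) auto
  obtain u where u: "u \<in> verts G" "M = norm (f u)"
    using Max_in[OF fin] unfolding M_def by auto
  have "M > 0"
  proof (rule ccontr)
    assume "\<not> M > 0"
    then have "f v = 0" if "v \<in> verts G" for v
      using M_ge[OF that] norm_ge_zero[of "f v"] by (metis dual_order.trans not_less norm_le_zero_iff)
    then have "x = 0\<^sub>v ?m" by (subst x_f) (use G(3) nth_mem[of _ vs] in \<open>auto intro!: eq_vecI\<close>)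
    then show False using x(2) by simp
  qed
  show thesis
  proof (rule that[of u "\<lambda>v. norm (f v) / M"])
    show "u \<in> verts G" "norm (f u) / M = 1" using u \<open>M > 0\<close> by auto
    fix v assume v: "v \<in> verts G"
    show "norm (f v) / M \<le> 1" using \<open>M > 0\<close> M_ge[OF v] by auto
    have "spectral_radius ?A * norm (f v) = norm (\<Sum>e\<in>out_arcs G v. f (head G e))"
      unfolding k(2) f_eq[OF v, symmetric] by (simp add: norm_mult)
    also have "\<dots> \<le> (\<Sum>e\<in>out_arcs G v. norm (f (head G e)))" by (rule norm_sum)
    finally show "spectral_radius ?A * (norm (f v) / M) \<le> (\<Sum>e\<in>out_arcs G v. norm (f (head G e)) / M)"
      using \<open>M > 0\<close> by (simp add: field_simps flip: sum_divide_distrib)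
  qed
qed

section \<open>Residues of the points given by walks\<close>

text \<open>
  The residue modulo \<open>p\<^sup>n\<close> of the point given by the walk \<open>w\<close>, when the edge \<open>e\<close> contributes the
  digit \<open>d e\<close>.
\<close>

definition digit_sum :: "nat \<Rightarrow> ('e \<Rightarrow> nat) \<Rightarrow> (nat \<Rightarrow> 'e) \<Rightarrow> nat \<Rightarrow> int" where
  "digit_sum p d w n = (\<Sum>k<n. int (d (w k)) * int p ^ k)"

lemma digit_sum_simps [simp]:
  "digit_sum p d w 0 = 0"
  "digit_sum p d w (Suc n) = digit_sum p d w n + int (d (w n)) * int p ^ n"
  by (simp_all add: digit_sum_def)

lemma digit_sum_Suc_shift:
  "digit_sum p d w (Suc n) = int (d (w 0)) + int p * digit_sum p d (\<lambda>k. w (Suc k)) n"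
  unfolding digit_sum_def by (subst sum.lessThan_Suc_shift) (simp add: sum_distrib_left algebra_simps)

lemma append_digit_bounds:
  fixes r q :: int
  assumes "0 \<le> r" "r < q ^ n" "0 \<le> a" "a < q" 
  shows "0 \<le> r + a * q ^ n" "r + a * q ^ n < q ^ Suc n"
proof -
  have "(a + 1) * q ^ n \<le> q * q ^ n" using assms by (intro mult_right_mono) auto
  then show "r + a * q ^ n < q ^ Suc n" using assms(2) by (simp add: algebra_simps)
  show "0 \<le> r + a * q ^ n" using assms by simp
qed

lemma digit_sum_bounds:
  assumes "\<And>k. d (w k) < p"
  shows "0 \<le> digit_sum p d w n" "digit_sum p d w n < int p ^ n"
proof -
  have "0 \<le> digit_sum p d w n \<and> digit_sum p d w n < int p ^ n"
    by (induction n) (use append_digit_bounds[of _ "int p"] assms in auto)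
  then show "0 \<le> digit_sum p d w n" "digit_sum p d w n < int p ^ n" by auto
qed

definition walk_residues :: "nat \<Rightarrow> ('e \<Rightarrow> nat) \<Rightarrow> ('v, 'e) pre_digraph \<Rightarrow> 'v \<Rightarrow> nat \<Rightarrow> int set" where
  "walk_residues p d G v n = {digit_sum p d w n | w. infinite_walk G v w}"

lemma infinite_walk_tail:
  assumes "infinite_walk G v w"
  shows "w 0 \<in> out_arcs G v" "infinite_walk G (head G (w 0)) (\<lambda>k. w (Suc k))"
  using assms unfolding infinite_walk_def by auto

lemma infinite_walk_cons:
  assumes "e \<in> out_arcs G v" "infinite_walk G (head G e) w"
  shows "infinite_walk G v (case_nat e w)"
  using assms unfolding infinite_walk_def by (auto split: nat.split)

text \<open>
  Splitting off the first edge gives for the residues the recursion that defines the walk count, but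
  as an inequality only: different walks may have the same digits, and finite walks that
  end in a dead end are counted although they yield no point.
\<close>

lemma card_walk_residues_le:
  assumes "fin_digraph G"
  shows "finite (walk_residues p d G v n) \<and> card (walk_residues p d G v n) \<le> walk_count G n v"
proof (induction n arbitrary: v)
  case 0
  have "walk_residues p d G v 0 \<subseteq> {0}" by (auto simp: walk_residues_def)
  then show ?case using finite_subset card_mono[of "{0::int}"] by fastforce
next
  case (Suc n)
  interpret fin_digraph G by fact
  let ?U = "\<Union>e\<in>out_arcs G v. (\<lambda>x. int (d e) + int p * x) ` walk_residues p d G (head G e) n"
  have sub: "walk_residues p d G v (Suc n) \<subseteq> ?U"
  proof
    fix x assume "x \<in> walk_residues p d G v (Suc n)"
    then obtain w where w: "infinite_walk G v w" "x = digit_sum p d w (Suc n)"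
      by (auto simp: walk_residues_def)
    show "x \<in> ?U"
      unfolding w(2) digit_sum_Suc_shift
      using infinite_walk_tail[OF w(1)] by (fastforce simp: walk_residues_def simp del: in_out_arcs_conv)
  qed
  have fin: "finite ?U" using Suc finite_out_arcs by blast
  have "card (walk_residues p d G v (Suc n)) \<le> card ?U" by (rule card_mono[OF fin sub])
  also have "\<dots> \<le> (\<Sum>e\<in>out_arcs G v. card ((\<lambda>x. int (d e) + int p * x) ` walk_residues p d G (head G e) n))"
    by (rule card_UN_le[OF finite_out_arcs])
  also have "\<dots> \<le> (\<Sum>e\<in>out_arcs G v. walk_count G n (head G e))"
    using Suc by (intro sum_mono) (meson card_image_le le_trans)
  finally show ?case using finite_subset[OF sub fin] by simp
qed

text \<open>
  The points of walks from \<open>u\<close> reappear among those of walks from \<open>v\<close>, contracted by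
  \<open>x \<mapsto> r + p\<^sup>k x\<close>: prepend a path of length \<open>k\<close> from \<open>v\<close> to \<open>u\<close>. This transfers smallness of
  covers from the initial vertex to the vertex where the subinvariant weight is maximal.
\<close>

lemma walk_prefix_residues:
  assumes "wf_digraph G" "reachable G v u" and d: "\<And>e. e \<in> arcs G \<Longrightarrow> d e < p"
  shows "\<exists>k r. 0 \<le> r \<and> r < int p ^ k \<and> (\<forall>w. infinite_walk G u w \<longrightarrow>
           (\<exists>w'. infinite_walk G v w' \<and>
              (\<forall>m. digit_sum p d w' (k + m) = r + int p ^ k * digit_sum p d w m)))"
proof -
  interpret wf_digraph G by fact
  from assms(2) show ?thesis
  proof (induction rule: converse_reachable_induct)
    case base
    show ?case by (rule exI[of _ 0], rule exI[of _ 0]) auto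
  next
    case (step a b)
    then obtain k r where IH: "0 \<le> r" "r < int p ^ k" "\<And>w. infinite_walk G u w \<Longrightarrow>
           (\<exists>w'. infinite_walk G b w' \<and>
              (\<forall>m. digit_sum p d w' (k + m) = r + int p ^ k * digit_sum p d w m))"
      by blast
    obtain e where e: "e \<in> out_arcs G a" "head G e = b"
      using step(1) by (auto simp: arcs_ends_def arc_to_ends_def)
    then have de: "d e < p" using d by auto
    let ?r = "int (d e) + int p * r"
    have "int p * (r + 1) \<le> int p * int p ^ k" using IH by (intro mult_left_mono) auto
    then have "?r < int p ^ Suc k" using de by (simp add: algebra_simps)
    moreover have "0 \<le> ?r" using IH by simp
    moreover have "\<exists>w'. infinite_walk G a w' \<and>
              (\<forall>m. digit_sum p d w' (Suc k + m) = ?r + int p ^ Suc k * digit_sum p d w m)"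
      if w: "infinite_walk G u w" for w
    proof -
      obtain w' where w': "infinite_walk G b w'"
        "\<And>m. digit_sum p d w' (k + m) = r + int p ^ k * digit_sum p d w m"
        using IH(3)[OF w] by blast
      show ?thesis
      proof (intro exI[of _ "case_nat e w'"] conjI allI)
        show "infinite_walk G a (case_nat e w')"
          by (rule infinite_walk_cons) (use e w' in auto)
        show "digit_sum p d (case_nat e w') (Suc k + m) = ?r + int p ^ Suc k * digit_sum p d w m" for m
          unfolding add_Suc digit_sum_Suc_shift by (simp add: w'(2) algebra_simps)
      qed
    qed
    ultimately show ?case by blast
  qed
qed

section \<open>A walk avoiding a light family of residue classes\<close>

text \<open>
  The family consists of the classes of \<open>c i\<close> modulo \<open>p\<close> to the power \<open>len i\<close>, weighing \<open>t\<close> to the power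
  \<open>len i\<close>. A state of the greedy walk is a vertex \<open>v\<close> together with the residue \<open>r\<close> modulo \<open>p\<^sup>n\<close>
  read so far. It is called light if the classes contained in the residue class of \<open>r\<close> weigh
  together less than \<open>t\<^sup>n \<cdot> y v\<close>. Subinvariance of \<open>y\<close> and disjointness of the classes of the possible
  next residues let a light state be followed by a light one, and in a light state the class of \<open>r\<close>
  cannot itself belong to the family.
\<close>

lemma walk_avoiding_cylinders:
  fixes y :: "'v \<Rightarrow> real" and G :: "('v, 'e) pre_digraph" and c :: "nat \<Rightarrow> int"
  assumes G: "fin_digraph G"
    and d: "\<And>e. e \<in> arcs G \<Longrightarrow> d e < p" 
    and inj: "\<And>v. v \<in> verts G \<Longrightarrow> inj_on d (out_arcs G v)"
    and t: "t > 0"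
    and y1: "\<And>v. v \<in> verts G \<Longrightarrow> y v \<le> 1"
    and y: "\<And>v. v \<in> verts G \<Longrightarrow> y v \<le> t * (\<Sum>e\<in>out_arcs G v. y (head G e))"
    and summable: "(\<lambda>i. t ^ len i) summable_on J"
    and u: "u \<in> verts G" and r: "0 \<le> r" "r < int p ^ k"
    and start: "(\<Sum>\<^sub>\<infinity>i\<in>{i \<in> J. k \<le> len i \<and> c i mod int p ^ k = r}. t ^ len i) < t ^ k * y u"
  obtains w where "infinite_walk G u w"
    "\<And>i. i \<in> J \<Longrightarrow> k \<le> len i \<Longrightarrow> c i \<noteq> r + int p ^ k * digit_sum p d w (len i - k)"
proof -
  interpret fin_digraph G by fact
  define below where "below n r = {i \<in> J. n \<le> len i \<and> c i mod int p ^ n = r}" for n r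
  define load where "load n r = (\<Sum>\<^sub>\<infinity>i\<in>below n r. t ^ len i)" for n r
  have below_summable: "(\<lambda>i. t ^ len i) summable_on below n r" for n r
    by (rule summable_on_subset_banach[OF summable]) (auto simp: below_def)
  define light where
    "light n r v \<longleftrightarrow> 0 \<le> r \<and> r < int p ^ n \<and> v \<in> verts G \<and> load n r < t ^ n * y v" for n r v
  (* If all successors were heavy, summing over the outgoing edges would give
     t^n * y v <= t^(n+1) * (SUM e. y (head e)) <= load n r, against lightness. *)
  have step: "\<exists>e\<in>out_arcs G v. light (Suc n) (r + int (d e) * int p ^ n) (head G e)"
    if L: "light n r v" for n r v
  proof (rule ccontr)
    assume neg: "\<not> ?thesis"
    let ?r = "\<lambda>e. r + int (d e) * int p ^ n"
    have r: "0 \<le> r" "r < int p ^ n" and v: "v \<in> verts G" and lt: "load n r < t ^ n * y v"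
      using L by (auto simp: light_def)
    have dp: "d e < p" "head G e \<in> verts G" if "e \<in> out_arcs G v" for e
      using that d by auto
    have heavy: "t ^ Suc n * y (head G e) \<le> load (Suc n) (?r e)" if e: "e \<in> out_arcs G v" for e
      using neg e dp[OF e] append_digit_bounds[OF r, of "int (d e)"] by (force simp: light_def simp del: in_out_arcs_conv)
    have disj: "below (Suc n) (?r e) \<inter> below (Suc n) (?r e') = {}"
      if "e \<in> out_arcs G v" "e' \<in> out_arcs G v" "e \<noteq> e'" for e e'
    proof -
      have "d e \<noteq> d e'" using inj_onD[OF inj[OF v]] that by blast
      then have "?r e \<noteq> ?r e'" using r dp(1)[OF that(1)] by auto
      then show ?thesis by (auto simp: below_def)
    qed
    have sub: "(\<Union>e\<in>out_arcs G v. below (Suc n) (?r e)) \<subseteq> below n r"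
    proof -
      have "c i mod int p ^ n = r" if "c i mod int p ^ Suc n = ?r e" for i e
      proof -
        have "c i mod int p ^ n = (c i mod int p ^ Suc n) mod int p ^ n"
          by (simp add: mod_mod_cancel)
        also have "\<dots> = r" unfolding that using r by simp
        finally show ?thesis .
      qed
      then show ?thesis by (auto simp: below_def simp del: power_Suc)
    qed
    have "t ^ n * y v \<le> t ^ n * (t * (\<Sum>e\<in>out_arcs G v. y (head G e)))"
      using y[OF v] t by (intro mult_left_mono) auto
    also have "\<dots> = (\<Sum>e\<in>out_arcs G v. t ^ Suc n * y (head G e))"
      by (simp add: sum_distrib_left algebra_simps)
    also have "\<dots> \<le> (\<Sum>e\<in>out_arcs G v. load (Suc n) (?r e))"
      by (intro sum_mono heavy)
    also have "\<dots> = (\<Sum>\<^sub>\<infinity>i\<in>(\<Union>e\<in>out_arcs G v. below (Suc n) (?r e)). t ^ len i)"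
      unfolding load_def by (rule sum_infsum) (use below_summable disj in auto)
    also have "\<dots> \<le> load n r"
      unfolding load_def
      by (rule infsum_mono2[OF summable_on_subset_banach[OF below_summable sub] below_summable sub])
        (use t in simp)
    finally show False using lt by simp
  qed
  (* Dependent choice of a sequence of light states, the m-th one at level k + m. *)
  define P where "P m x \<longleftrightarrow> light (k + m) (fst x) (snd x) \<and> (m = 0 \<longrightarrow> x = (r, u))" for m and x :: "int \<times> 'v"
  define Q where "Q m x x' \<longleftrightarrow> (\<exists>e\<in>out_arcs G (snd x).
      x' = (fst x + int (d e) * int p ^ (k + m), head G e))" for m and x x' :: "int \<times> 'v"
  have "\<exists>f. \<forall>m. P m (f m) \<and> Q m (f m) (f (Suc m))"
  proof (rule dependent_nat_choice)
    show "\<exists>x. P 0 x"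
      using u r start by (auto simp: P_def light_def load_def below_def)
    show "\<exists>x'. P (Suc m) x' \<and> Q m x x'" if "P m x" for m x
      using that step[of "k + m" "fst x" "snd x"] unfolding P_def Q_def by fastforce
  qed
  then obtain f where f: "\<And>m. P m (f m)" "\<And>m. Q m (f m) (f (Suc m))" by blast
  then obtain w where w: "\<And>m. w m \<in> out_arcs G (snd (f m))"
    "\<And>m. f (Suc m) = (fst (f m) + int (d (w m)) * int p ^ (k + m), head G (w m))"
    unfolding Q_def by metis
  have f0: "f 0 = (r, u)" using f(1)[of 0] by (simp add: P_def)
  have walk: "infinite_walk G u w"
    unfolding infinite_walk_def using w f0 by (metis in_out_arcs_conv snd_conv)
  have residue: "fst (f m) = r + int p ^ k * digit_sum p d w m" for m
    by (induction m) (simp_all add: f0 w(2) algebra_simps power_add)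
  show thesis
  proof (rule that[OF walk])
    fix i assume i: "i \<in> J" "k \<le> len i"
    show "c i \<noteq> r + int p ^ k * digit_sum p d w (len i - k)"
    proof
      assume ci: "c i = r + int p ^ k * digit_sum p d w (len i - k)"
      let ?x = "f (len i - k)"
      have fx: "fst ?x = c i" unfolding residue ci ..
      have L: "light (len i) (c i) (snd ?x)"
        using f(1)[of "len i - k"] i(2) unfolding P_def fx by simp
      then have "c i mod int p ^ len i = c i" by (simp add: light_def)
      then have sub: "{i} \<subseteq> below (len i) (c i)" using i(1) by (simp add: below_def)
      have "(\<Sum>\<^sub>\<infinity>j\<in>{i}. t ^ len j) \<le> load (len i) (c i)"
        unfolding load_def by (rule infsum_mono2[OF _ below_summable sub]) (use t in auto)
      moreover have "load (len i) (c i) < t ^ len i * 1"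
      proof -
        have "load (len i) (c i) < t ^ len i * y (snd ?x)" "snd ?x \<in> verts G"
          using L by (auto simp: light_def)
        moreover have "t ^ len i * y (snd ?x) \<le> t ^ len i * 1"
          using t y1 \<open>snd ?x \<in> verts G\<close> by (intro mult_left_mono) auto
        ultimately show ?thesis by simp
      qed
      ultimately show False by simp
    qed
  qed
qed

section \<open>Hausdorff measure on the p-adic integers\<close>

lemma padic_dist_le_one:
  assumes "p \<ge> 2" "x \<in> padic_ints p" "y \<in> padic_ints p"
  shows "padic_dist p x y \<le> 1"
  using padic_dist_le_iff[OF assms, of 0] padic_ints_bounds[OF assms(2), of 0] padic_ints_bounds[OF assms(3), of 0]
  by simp

lemma padic_dist_nonneg: "0 \<le> padic_dist p x y"
  by (simp add: padic_dist_def padic_norm_def)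

lemma powr_neg_power:
  assumes "p > 0"
  shows "(1 / real p ^ n) powr s = (real p powr - s) ^ n"
proof -
  have "1 / real p ^ n = real p powr (- real n)" using assms by (simp add: powr_minus_divide powr_realpow)
  then show ?thesis using assms by (simp add: powr_powr powr_power mult.commute)
qed

lemma diam_powr_le_of_residue:
  assumes p: "p \<ge> 2" and s: "s \<ge> 0" and U: "U \<subseteq> padic_ints p"
    and eq: "\<And>x y. x \<in> U \<Longrightarrow> y \<in> U \<Longrightarrow> x n = y n"
  shows "diam_powr (padic_dist p) s U \<le> (real p powr - s) ^ n"
proof (cases "U = {} \<or> s = 0")
  case True
  then show ?thesis using p by (auto simp: diam_powr_def)
next
  case False
  have le: "padic_dist p (fst xy) (snd xy) \<le> 1 / real p ^ n" if "xy \<in> U \<times> U" for xy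
    using padic_dist_le_iff[OF p, of "fst xy" "snd xy" n] U eq[of "fst xy" "snd xy"] that
    by (cases xy) auto
  obtain x where x: "x \<in> U" using False by auto
  have "set_diam (padic_dist p) U \<le> 1 / real p ^ n"
    unfolding set_diam_def using False le by (auto intro!: cSUP_least)
  moreover have "0 \<le> set_diam (padic_dist p) U"
  proof -
    have "bdd_above ((\<lambda>xy. padic_dist p (fst xy) (snd xy)) ` (U \<times> U))"
      using le by (intro bdd_aboveI2[where M = "1 / real p ^ n"]) auto
    from cSUP_upper[OF _ this, of "(x, x)"] show ?thesis
      using x padic_dist_nonneg[of p x x] by (auto simp: set_diam_def)
  qed
  ultimately have "set_diam (padic_dist p) U powr s \<le> (1 / real p ^ n) powr s"
    using s by (intro powr_mono2) auto
  then show ?thesis using False powr_neg_power[of p n s] p by (simp add: diam_powr_def)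
qed

text \<open>
  Distances are powers of \<open>p\<close>, so a set whose points agree modulo \<open>p\<^sup>n\<close> but not modulo the next power
  has diameter exactly \<open>p\<^sup>-\<^sup>n\<close>, and passing to the residue class containing it costs nothing. The
  margin \<open>\<epsilon>\<close> is for one-point sets when \<open>s > 0\<close>: their diameter is \<open>0\<close>, whereas residue classes
  have positive weight.
\<close>

lemma residue_le_diam_powr:
  assumes p: "p \<ge> 2" and s: "s \<ge> 0" and U: "U \<subseteq> padic_ints p" "U \<noteq> {}" and eps: "\<epsilon> > 0"
  obtains n c where "\<And>x. x \<in> U \<Longrightarrow> x n = c" "(real p powr - s) ^ n \<le> diam_powr (padic_dist p) s U + \<epsilon>"
proof -
  let ?q = "real p powr - s"
  obtain x0 where x0: "x0 \<in> U" using U by auto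
  have zero: "x 0 = 0" if "x \<in> U" for x
    using padic_ints_bounds[of x p 0] that U by force
  have "\<exists>n. (\<forall>x\<in>U. \<forall>y\<in>U. x n = y n) \<and> ?q ^ n \<le> diam_powr (padic_dist p) s U + \<epsilon>"
  proof (cases "s = 0")
    case True
    moreover have "\<forall>x\<in>U. \<forall>y\<in>U. x 0 = y 0" using zero by metis
    ultimately show ?thesis using U(2) eps p by (intro exI[of _ 0]) (simp add: diam_powr_def)
  next
    case False
    then have s: "s > 0" using s by simp
    show ?thesis
    proof (cases "\<forall>n. \<forall>x\<in>U. \<forall>y\<in>U. x n = y n")
      case True
      have "?q < 1" using p s by (simp add: powr_less_one)
      then obtain n where "?q ^ n < \<epsilon>" using real_arch_pow_inv[OF eps] by blast
      moreover have "diam_powr (padic_dist p) s U \<ge> 0" by (simp add: diam_powr_def)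
      ultimately show ?thesis using True by (intro exI[of _ n]) auto
    next
      case False
      (* The first level m at which the points disagree; m = 0 is impossible modulo 1. *)
      define m where "m = (LEAST m. \<not> (\<forall>x\<in>U. \<forall>y\<in>U. x m = y m))"
      have m: "\<not> (\<forall>x\<in>U. \<forall>y\<in>U. x m = y m)"
        unfolding m_def using False LeastI_ex[of "\<lambda>m. \<not> (\<forall>x\<in>U. \<forall>y\<in>U. x m = y m)"] by blast
      moreover have "\<forall>x\<in>U. \<forall>y\<in>U. x 0 = y 0" using zero by metis
      ultimately have "m \<noteq> 0" by metis
      then obtain n where n: "m = Suc n" using not0_implies_Suc by blast
      have agree: "\<forall>x\<in>U. \<forall>y\<in>U. x n = y n"
        using not_less_Least[of n "\<lambda>m. \<not> (\<forall>x\<in>U. \<forall>y\<in>U. x m = y m)"] n m_def by auto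
      obtain x y where xy: "x \<in> U" "y \<in> U" "x (Suc n) \<noteq> y (Suc n)" using m n by auto
      have not_le: "\<not> padic_dist p x y \<le> 1 / real p ^ Suc n"
        using padic_dist_le_iff[OF p, of x y "Suc n"] xy U by blast
      have pos: "\<not> padic_dist p x y \<le> 0" 
      proof
        assume "padic_dist p x y \<le> 0"
        also have "0 \<le> 1 / real p ^ Suc n" by simp
        finally show False using not_le by simp
      qed
      then obtain j where j: "padic_dist p x y = 1 / real p ^ j"
        using padic_dist_cases[of p x y] by auto
      have "j \<le> n"
      proof (rule ccontr)
        assume "\<not> j \<le> n"
        then have "1 / real p ^ j \<le> 1 / real p ^ Suc n"
          using p by (intro divide_left_mono power_increasing) auto
        then show False using not_le j by simp
      qed
      then have "1 / real p ^ n \<le> padic_dist p x y"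
        unfolding j using p by (intro divide_left_mono power_increasing) auto
      also have "\<dots> \<le> set_diam (padic_dist p) U"
      proof -
        have "bdd_above ((\<lambda>xy. padic_dist p (fst xy) (snd xy)) ` (U \<times> U))"
          using padic_dist_le_one[OF p] subsetD[OF U(1)] by (intro bdd_aboveI2[where M = 1]) auto
        from cSUP_upper[OF _ this, of "(x, y)"] show ?thesis
          using xy U by (auto simp: set_diam_def)
      qed
      finally have "(1 / real p ^ n) powr s \<le> set_diam (padic_dist p) U powr s"
        using s by (intro powr_mono2) auto
      then have "?q ^ n \<le> diam_powr (padic_dist p) s U + \<epsilon>"
        using powr_neg_power[of p n s] p s U eps by (simp add: diam_powr_def)
      then show ?thesis using agree by blast
    qed
  qed
  then obtain n where "\<And>x y. x \<in> U \<Longrightarrow> y \<in> U \<Longrightarrow> x n = y n" "?q ^ n \<le> diam_powr (padic_dist p) s U + \<epsilon>"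
    by blast
  then show thesis using that[of n "x0 n"] x0 by blast
qed

text \<open>
  The cover by residue classes modulo \<open>p\<^sup>n\<close> has total weight at most \<open>C (r / p\<^sup>s)\<^sup>n\<close>, which tends to \<open>0\<close>.
\<close>

lemma hausdorff_measure_eq_0_of_few_residues:
  fixes C r :: real
  assumes p: "p \<ge> 2" and s: "s \<ge> 0" and Y: "Y \<subseteq> padic_ints p"
    and fin: "\<And>n. finite ((\<lambda>x. x n) ` Y)"
    and card: "\<And>n. card ((\<lambda>x. x n) ` Y) \<le> C * r ^ n" and r: "0 < r" "r < real p powr s"
  shows "hausdorff_measure (padic_ints p) (padic_dist p) s Y = 0"
proof -
  let ?q = "real p powr - s"
  have rq: "0 < r * ?q" "r * ?q < 1" using r p by (auto simp: powr_minus_divide)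
  have "hausdorff_premeasure (padic_ints p) (padic_dist p) s \<delta> Y \<le> ennreal \<epsilon>"
    if "\<delta> > 0" "\<epsilon> > 0" for \<delta> \<epsilon> :: real
  proof -
    have "(\<lambda>n. C * (r * ?q) ^ n) \<longlonglongrightarrow> C * 0"
      using rq by (intro tendsto_intros LIMSEQ_power_zero) auto
    then have "\<forall>\<^sub>F n in sequentially. C * (r * ?q) ^ n < \<epsilon>"
      using that(2) by (intro order_tendstoD) auto
    moreover have "(\<lambda>n. (1 / real p) ^ n) \<longlonglongrightarrow> 0"
      using p by (intro LIMSEQ_power_zero) auto
    then have "\<forall>\<^sub>F n in sequentially. (1 / real p) ^ n < \<delta>"
      using that(1) by (intro order_tendstoD) auto
    ultimately have "\<forall>\<^sub>F n in sequentially. C * (r * ?q) ^ n < \<epsilon> \<and> (1 / real p) ^ n < \<delta>"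
      by eventually_elim simp
    then obtain n where n: "C * (r * ?q) ^ n < \<epsilon>" "1 / real p ^ n < \<delta>"
      by (auto simp: eventually_sequentially power_one_over)
    define R where "R = (\<lambda>x. x n) ` Y"
    obtain g where g: "bij_betw g {0..<card R} R"
      using ex_bij_betw_nat_finite[of R] fin R_def by auto
    define U where "U i = (if i < card R then {x \<in> padic_ints p. x n = g i} else {})" for i
    have dist: "padic_dist p x y \<le> \<delta>" if "x \<in> U i" "y \<in> U i" for i x y
      using padic_dist_le_iff[OF p, of x y n] that n by (auto simp: U_def split: if_splits)
    have cover: "Y \<subseteq> (\<Union>i. U i)"
    proof
      fix x assume x: "x \<in> Y"
      then have "x n \<in> g ` {0..<card R}" using g unfolding bij_betw_def R_def by auto
      then obtain i where "i < card R" "x n = g i" by auto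
      then show "x \<in> (\<Union>i. U i)" using x Y by (auto simp: U_def intro!: exI[of _ i])
    qed
    have "U \<in> delta_covers (padic_ints p) (padic_dist p) \<delta> Y"
      unfolding delta_covers_def using dist cover by (auto simp: U_def)
    then have "hausdorff_premeasure (padic_ints p) (padic_dist p) s \<delta> Y
        \<le> (\<Sum>i. ennreal (diam_powr (padic_dist p) s (U i)))"
      unfolding hausdorff_premeasure_def by (rule INF_lower)
    also have "\<dots> = (\<Sum>i<card R. ennreal (diam_powr (padic_dist p) s (U i)))"
      by (rule suminf_finite) (auto simp: U_def diam_powr_def)
    also have "\<dots> \<le> (\<Sum>i<card R. ennreal (?q ^ n))"
      using p s by (intro sum_mono ennreal_leI diam_powr_le_of_residue) (auto simp: U_def)
    also have "\<dots> = ennreal (card R * ?q ^ n)"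
      by (simp add: ennreal_mult' ennreal_of_nat_eq_real_of_nat)
    also have "\<dots> \<le> ennreal \<epsilon>"
    proof (rule ennreal_leI)
      have "card R * ?q ^ n \<le> (C * r ^ n) * ?q ^ n"
        using card[of n] by (intro mult_right_mono) (auto simp: R_def)
      then show "card R * ?q ^ n \<le> \<epsilon>" using n by (simp add: power_mult_distrib algebra_simps)
    qed
    finally show ?thesis .
  qed
  then have "hausdorff_premeasure (padic_ints p) (padic_dist p) s \<delta> Y = 0" if "\<delta> > 0" for \<delta>
    using that ennreal_le_epsilon[of 0 "hausdorff_premeasure (padic_ints p) (padic_dist p) s \<delta> Y"]
    by (metis add.left_neutral ennreal_le_epsilon le_zero_eq)
  then show ?thesis unfolding hausdorff_measure_def by simp
qed

text \<open>
  Each set of a good cover is enlarged to a residue class by \<open>residue_le_diam_powr\<close>, with margins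
  \<open>\<epsilon> / 4, \<epsilon> / 8, \<dots>\<close> that add up to \<open>\<epsilon> / 2\<close>. The index set \<open>J\<close> leaves out the empty sets of the
  cover: for \<open>s = 0\<close> every residue class weighs \<open>1\<close>, so that an empty set could not be enlarged
  cheaply.
\<close>

lemma hausdorff_null_cylinder_cover:
  assumes p: "p \<ge> 2" and s: "s \<ge> 0"
    and null: "hausdorff_measure (padic_ints p) (padic_dist p) s Y = 0" and eps: "\<epsilon> > 0"
  obtains J :: "nat set" and len :: "nat \<Rightarrow> nat" and c :: "nat \<Rightarrow> int"
  where "(\<lambda>i. (real p powr - s) ^ len i) summable_on J"
    "(\<Sum>\<^sub>\<infinity>i\<in>J. (real p powr - s) ^ len i) < \<epsilon>"
    "\<And>x. x \<in> Y \<Longrightarrow> \<exists>i\<in>J. x (len i) = c i"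
proof -
  let ?q = "real p powr - s" and ?D = "diam_powr (padic_dist p) s"
  have "hausdorff_premeasure (padic_ints p) (padic_dist p) s 1 Y \<le> 0"
    unfolding null[symmetric] hausdorff_measure_def by (intro SUP_upper) auto
  also have "0 < ennreal (\<epsilon> / 2)" using eps by simp
  finally obtain U where U: "U \<in> delta_covers (padic_ints p) (padic_dist p) 1 Y"
    "(\<Sum>i. ennreal (?D (U i))) < ennreal (\<epsilon> / 2)"
    unfolding hausdorff_premeasure_def INF_less_iff by blast
  have D0: "?D V \<ge> 0" for V by (simp add: diam_powr_def)
  have D: "summable (\<lambda>i. ?D (U i))" "(\<Sum>i. ?D (U i)) < \<epsilon> / 2"
  proof -
    show *: "summable (\<lambda>i. ?D (U i))"
      using U(2) D0 by (intro summable_suminf_not_top) auto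
    show "(\<Sum>i. ?D (U i)) < \<epsilon> / 2"
      using U(2) eps D0 suminf_nonneg[OF * D0] unfolding suminf_ennreal2[OF D0 *]
      by (subst (asm) ennreal_less_iff) auto
  qed
  define g where "g i = ?D (U i) + \<epsilon> / 4 * (1 / 2) ^ i" for i
  define J where "J = {i. U i \<noteq> {}}"
  have "\<exists>n c. (\<forall>x\<in>U i. x n = c) \<and> ?q ^ n \<le> g i" if "i \<in> J" for i
    using residue_le_diam_powr[OF p s, of "U i" "\<epsilon> / 4 * (1 / 2) ^ i"] that U(1) eps
    unfolding J_def g_def delta_covers_def by (smt (verit) mem_Collect_eq zero_less_power divide_pos_pos mult_pos_pos)
  then obtain len c where len: "\<And>i x. i \<in> J \<Longrightarrow> x \<in> U i \<Longrightarrow> x (len i) = c i"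
    "\<And>i. i \<in> J \<Longrightarrow> ?q ^ len i \<le> g i"
    by metis
  have "g sums ((\<Sum>i. ?D (U i)) + \<epsilon> / 4 * (1 / (1 - 1 / 2)))"
    unfolding g_def by (intro sums_add summable_sums[OF D(1)] sums_mult geometric_sums) simp
  then have "(g has_sum ((\<Sum>i. ?D (U i)) + \<epsilon> / 2)) UNIV"
    using D0 eps by (intro sums_nonneg_imp_has_sum) (auto simp: g_def)
  then have g: "g summable_on UNIV" "infsum g UNIV = (\<Sum>i. ?D (U i)) + \<epsilon> / 2"
    by (auto simp: has_sum_iff)
  have g_nonneg: "g i \<ge> 0" for i unfolding g_def using D0[of "U i"] eps by simp
  have gJ: "g summable_on J" by (rule summable_on_subset_banach[OF g(1)]) simp
  have q: "(\<lambda>i. ?q ^ len i) summable_on J"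
    by (rule summable_on_comparison_test[OF gJ]) (use len in auto)
  have "(\<Sum>\<^sub>\<infinity>i\<in>J. ?q ^ len i) \<le> infsum g J"
    by (rule infsum_mono[OF q gJ]) (rule len(2))
  also have "\<dots> \<le> infsum g UNIV"
    by (rule infsum_mono2[OF gJ g(1)]) (use g_nonneg in auto)
  also have "\<dots> < \<epsilon>" using g D by simp
  finally have lt: "(\<Sum>\<^sub>\<infinity>i\<in>J. ?q ^ len i) < \<epsilon>" .
  have "\<exists>i\<in>J. x (len i) = c i" if "x \<in> Y" for x
  proof -
    from \<open>x \<in> Y\<close> obtain i where "x \<in> U i" using U(1) unfolding delta_covers_def by blast
    then show ?thesis using len(1)[of i x] by (auto simp: J_def)
  qed
  then show thesis using that[OF q lt] by blast
qed

section \<open>The dimension formula\<close>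

theorem theorem1p1:
  fixes p :: nat
    and Y :: "(nat \<Rightarrow> int) set"
    and A :: "'a set"
    and fbar :: "'a \<Rightarrow> nat"
    and G :: "('v, 'e) pre_digraph"
    and lab :: "'e \<Rightarrow> 'a"
    and v0 :: 'v
    and vs :: "'v list"
  assumes "prime p"
    and "Y \<in> padic_path_set_fractals p"
    and "Y \<noteq> {}"
    and "standard_presentation p A fbar G lab v0 Y"
    and "distinct vs" and "set vs = verts G"
  shows "hausdorff_dim (padic_ints p) (padic_dist p) Y
           = ereal (log (real p) (spectral_radius (adjacency_matrix G vs)))
       \<and> log (real p) (spectral_radius (adjacency_matrix G vs))
           = ln (spectral_radius (adjacency_matrix G vs)) / ln (real p)"
proof -
  define \<rho> where "\<rho> = spectral_radius (adjacency_matrix G vs)"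
  define d where "d e = fbar (lab e)" for e
  have p: "p \<ge> 2" using assms(1) by (rule prime_ge_2_nat)
  have fin: "fin_digraph G" and labA: "\<And>e. e \<in> arcs G \<Longrightarrow> lab e \<in> A" and v0: "v0 \<in> verts G"
    and fb: "\<And>a. a \<in> A \<Longrightarrow> fbar a < p" and Y: "Y = digit_map p fbar ` path_set G lab v0"
    and injA: "inj_on fbar A" and rr: "right_resolving G lab" and reach: "all_reachable G v0"
    using assms(4) unfolding standard_presentation_def presentation_def pointed_labeled_graph_def by auto
  interpret fin_digraph G by (rule fin)
  have d: "d e < p" if "e \<in> arcs G" for e using that labA fb by (simp add: d_def)
  have inj: "inj_on d (out_arcs G v)" if "v \<in> verts G" for v
  proof (rule inj_onI)
    fix e e' assume e: "e \<in> out_arcs G v" "e' \<in> out_arcs G v" "d e = d e'"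
    then have "lab e = lab e'" using inj_onD[OF injA] labA by (auto simp: d_def)
    then show "e = e'" using rr e that unfolding right_resolving_def inj_on_def by auto
  qed
  have residue: "digit_map p fbar (\<lambda>n. lab (w n)) n = digit_sum p d w n" if "infinite_walk G v w" for v w n
    using digit_sum_bounds[of d w p n] d that
    unfolding digit_map_def digit_sum_def infinite_walk_def d_def by simp
  have Y_eq: "Y = {digit_sum p d w | w. infinite_walk G v0 w}"
  proof -
    have "digit_map p fbar (\<lambda>n. lab (w n)) = digit_sum p d w" if "infinite_walk G v0 w" for w
      using residue[OF that] by auto
    then show ?thesis unfolding Y path_set_def by (force simp: image_iff)
  qed
  have Y_sub: "Y \<subseteq> padic_ints p" unfolding Y using digit_map_in_padic_ints[OF p] by auto
  have Y_res: "(\<lambda>x. x n) ` Y = walk_residues p d G v0 n" for n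
    unfolding Y_eq walk_residues_def by auto
  have card_le: "finite ((\<lambda>x. x n) ` Y)" "card ((\<lambda>x. x n) ` Y) \<le> walk_count G n v0" for n
    using card_walk_residues_le[OF fin, of p d v0 n] by (auto simp: Y_res)

  (* Otherwise the number of residues of Y modulo p^n would tend to 0 although Y is nonempty. *)
  have "\<rho> \<ge> 1"
  proof (rule ccontr)
    assume "\<not> \<rho> \<ge> 1"
    then obtain r where r: "0 < r" "\<rho> < r" "r < 1" 
      using dense[of "max 0 \<rho>" 1] by auto
    obtain C where C: "\<And>n v. v \<in> verts G \<Longrightarrow> walk_count G n v \<le> C * r ^ n"
      using walk_count_le_power[OF fin assms(5,6), of r] r \<rho>_def by blast
    have ge: "1 \<le> C * r ^ n" for n
    proof -
      have "0 < card ((\<lambda>x. x n) ` Y)" using card_le(1) assms(3) by (simp add: card_gt_0_iff)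
      then have "1 \<le> walk_count G n v0" using card_le(2)[of n] by linarith
      then show ?thesis using C[OF v0, of n] by linarith
    qed
    have "(\<lambda>n. C * r ^ n) \<longlonglongrightarrow> C * 0"
      using r by (intro tendsto_intros LIMSEQ_power_zero) auto
    then have "1 \<le> C * 0" by (rule LIMSEQ_le_const) (use ge in auto)
    then show False by simp
  qed

  have upper: "hausdorff_measure (padic_ints p) (padic_dist p) s Y = 0" if s: "log p \<rho> < s" for s
  proof -
    have "\<rho> < real p powr s" using s p \<open>\<rho> \<ge> 1\<close> by (simp add: log_less_iff)
    then obtain r where r: "\<rho> < r" "r < real p powr s" using dense by blast
    then have "0 < r" using \<open>\<rho> \<ge> 1\<close> by simp
    obtain C where C: "\<And>n v. v \<in> verts G \<Longrightarrow> walk_count G n v \<le> C * r ^ n"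
      using walk_count_le_power[OF fin assms(5,6), of r] r \<open>0 < r\<close> \<rho>_def by blast
    have "0 \<le> log p \<rho>" using p \<open>\<rho> \<ge> 1\<close> by simp
    then have "s \<ge> 0" using s by simp
    show ?thesis
    proof (rule hausdorff_measure_eq_0_of_few_residues[OF p \<open>s \<ge> 0\<close> Y_sub card_le(1) _ \<open>0 < r\<close> r(2)])
      show "card ((\<lambda>x. x n) ` Y) \<le> C * r ^ n" for n
        using card_le(2)[of n] C[OF v0, of n] by linarith
    qed
  qed

  have lower: "log p \<rho> \<le> s"
    if s: "0 \<le> s" and null: "hausdorff_measure (padic_ints p) (padic_dist p) s Y = 0" for s
  proof (rule ccontr)
    assume "\<not> log p \<rho> \<le> s"
    then have ps: "real p powr s \<le> \<rho>" using p \<open>\<rho> \<ge> 1\<close> by (simp add: not_le less_log_iff)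
    define q where "q = real p powr - s"
    define t where "t = 1 / \<rho>"
    have t: "0 < t" "t \<le> 1" using \<open>\<rho> \<ge> 1\<close> by (simp_all add: t_def)
    have "real p powr s > 0" using p by simp
    then have "t \<le> q"
      using frac_le[of 1 1 "real p powr s" \<rho>] ps unfolding t_def q_def powr_minus_divide by simp
    obtain y u where u: "u \<in> verts G" "y u = 1" and y1: "\<And>v. v \<in> verts G \<Longrightarrow> y v \<le> 1"
      and y: "\<And>v. v \<in> verts G \<Longrightarrow> \<rho> * y v \<le> (\<Sum>e\<in>out_arcs G v. y (head G e))"
    proof (rule subinvariant_weight[OF fin assms(5,6), folded \<rho>_def])
      show "verts G \<noteq> {}" using v0 by auto
    qed (rule that)
    have y': "y v \<le> t * (\<Sum>e\<in>out_arcs G v. y (head G e))" if "v \<in> verts G" for v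
      using y[OF that] \<open>\<rho> \<ge> 1\<close> by (simp add: t_def field_simps)
    have "reachable G v0 u" using reach u by (simp add: all_reachable_def)
    then obtain k r where r: "0 \<le> r" "r < int p ^ k" and prefix: "\<And>w. infinite_walk G u w \<Longrightarrow>
        \<exists>w'. infinite_walk G v0 w' \<and> (\<forall>m. digit_sum p d w' (k + m) = r + int p ^ k * digit_sum p d w m)"
      using walk_prefix_residues[OF wf_digraph_axioms, of v0 u d p] d by blast
    (* The bound t^k is the weight of the residue class of level k reached together with u, where the
       subinvariant weight is 1; so the state (k, r, u) is light. *)
    obtain J :: "nat set" and len c where q: "(\<lambda>i. q ^ len i) summable_on J" "(\<Sum>\<^sub>\<infinity>i\<in>J. q ^ len i) < t ^ k"
      and cover: "\<And>x. x \<in> Y \<Longrightarrow> \<exists>i\<in>J. x (len i) = c i"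
    proof (rule hausdorff_null_cylinder_cover[OF p s null, folded q_def])
      show "0 < t ^ k" using t by simp
    qed (rule that)
    have tq: "t ^ n \<le> q ^ n" for n using t \<open>t \<le> q\<close> by (intro power_mono) auto
    have tJ: "(\<lambda>i. t ^ len i) summable_on J"
      by (rule summable_on_comparison_test[OF q(1)]) (use tq t in auto)
    have sum_t: "(\<Sum>\<^sub>\<infinity>i\<in>J. t ^ len i) < t ^ k"
      using infsum_mono[OF tJ q(1) tq] q(2) by linarith
    have part: "(\<Sum>\<^sub>\<infinity>i\<in>J'. t ^ len i) \<le> (\<Sum>\<^sub>\<infinity>i\<in>J. t ^ len i)" if "J' \<subseteq> J" for J'
      by (rule infsum_mono2[OF summable_on_subset_banach[OF tJ that] tJ that]) (use t in auto)
    (* A single class of level below k would already exceed the total weight. *)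
    have deep: "k \<le> len i" if i: "i \<in> J" for i
    proof (rule ccontr)
      assume "\<not> k \<le> len i"
      then have "t ^ k \<le> t ^ len i" using t by (intro power_decreasing) auto
      then show False using part[of "{i}"] i sum_t by simp
    qed
    have start: "(\<Sum>\<^sub>\<infinity>i\<in>{i \<in> J. k \<le> len i \<and> c i mod int p ^ k = r}. t ^ len i) < t ^ k * y u"
      using part[of "{i \<in> J. k \<le> len i \<and> c i mod int p ^ k = r}"] sum_t u(2) by auto
    have "\<exists>w. infinite_walk G u w \<and>
        (\<forall>i\<in>J. k \<le> len i \<longrightarrow> c i \<noteq> r + int p ^ k * digit_sum p d w (len i - k))"
    proof (rule walk_avoiding_cylinders[where d = d and y = y and c = c,
          OF fin _ _ t(1) _ _ tJ u(1) r start])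
      fix w assume "infinite_walk G u w"
        "\<And>i. i \<in> J \<Longrightarrow> k \<le> len i \<Longrightarrow> c i \<noteq> r + int p ^ k * digit_sum p d w (len i - k)"
      then show ?thesis by blast
    qed (rule d inj y1 y', assumption)+
    then obtain w where w: "infinite_walk G u w"
      "\<And>i. i \<in> J \<Longrightarrow> k \<le> len i \<Longrightarrow> c i \<noteq> r + int p ^ k * digit_sum p d w (len i - k)"
      by blast
    obtain w' where w': "infinite_walk G v0 w'"
      "\<And>m. digit_sum p d w' (k + m) = r + int p ^ k * digit_sum p d w m"
      using prefix[OF w(1)] by blast
    then obtain i where "i \<in> J" "digit_sum p d w' (len i) = c i"
      using cover[of "digit_sum p d w'"] unfolding Y_eq by blast
    then show False using w(2)[of i] w'(2)[of "len i - k"] deep[of i] by simp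
  qed

  have "hausdorff_dim (padic_ints p) (padic_dist p) Y = ereal (log p \<rho>)"
    unfolding hausdorff_dim_def
  proof (rule antisym)
    show "ereal (log p \<rho>) \<le> Inf (ereal ` {s. 0 \<le> s \<and> hausdorff_measure (padic_ints p) (padic_dist p) s Y = 0})"
      using lower by (intro Inf_greatest) auto
    have "0 \<le> log p \<rho>" using p \<open>\<rho> \<ge> 1\<close> by simp
    then have mem: "s \<in> {s. 0 \<le> s \<and> hausdorff_measure (padic_ints p) (padic_dist p) s Y = 0}"
      if "log p \<rho> < s" for s
      using upper[OF that] that by auto
    show "Inf (ereal ` {s. 0 \<le> s \<and> hausdorff_measure (padic_ints p) (padic_dist p) s Y = 0}) \<le> ereal (log p \<rho>)"
    proof (rule ereal_le_epsilon2)
      fix \<epsilon> :: real assume "0 < \<epsilon>"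
      then have "log p \<rho> + \<epsilon> \<in> {s. 0 \<le> s \<and> hausdorff_measure (padic_ints p) (padic_dist p) s Y = 0}"
        by (intro mem) simp
      then show "Inf (ereal ` {s. 0 \<le> s \<and> hausdorff_measure (padic_ints p) (padic_dist p) s Y = 0})
          \<le> ereal (log p \<rho>) + ereal \<epsilon>"
        unfolding plus_ereal.simps by (intro Inf_lower imageI)
    qed
  qed
  then show ?thesis unfolding \<rho>_def by (simp add: log_def)
qed

end
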